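(* Let $R$ be a commutative ring and $\mathfrak a\subseteq R$ an ideal. The following statements are equivalent: (i) $\mathfrak a$ is weakly large quasifair, i.e., $\operatorname{Ass}^{\mathrm f}_R(\overline\Gamma_{\mathfrak a}(M))=\operatorname{Ass}^{\mathrm f}_R(M)\cap\operatorname{Var}(\mathfrak a)$ for every $R$-module $M$; (ii) for every $R$-module $M$ we have $\overline\Gamma_{\mathfrak a}(M)=0\Leftrightarrow\operatorname{Ass}^{\mathrm f}_R(M)\cap\operatorname{Var}(\mathfrak a)=\emptyset$.
   Context: Rings are commutative with unit (possibly zero). For a ring $R$, an ideal $\mathfrak a\subseteq R$ and an $R$-module $M$: $\operatorname{Var}(\mathfrak a)=\{\mathfrak p\in\operatorname{Spec}(R)\mid\mathfrak a\subseteq\mathfrak p\}$; $\overline\Gamma_{\mathfrak a}(M)=\{x\in M\mid\mathfrak a\subseteq\sqrt{(0:_Rx)}\}$ (large $\mathfrak a$-torsion submodule); $\operatorname{Ass}^{\mathrm f}_R(M)=\{\mathfrak p\in\operatorname{Spec}(R)\mid\exists x\in M:\mathfrak p\in\min(0:_Rx)\}$ (weak assassin), where $\min(\mathfrak b)$ is the set of minimal elements of $\operatorname{Var}(\mathfrak b)$. *)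

theory Defs
  imports "HOL-Algebra.Ideal" "HOL-Algebra.Module"
begin

definition Spec :: "('a, 'r) ring_scheme \<Rightarrow> 'a set set"
  where "Spec R = {p. primeideal p R}"

definition Var :: "('a, 'r) ring_scheme \<Rightarrow> 'a set \<Rightarrow> 'a set set"
  where "Var R I = {p \<in> Spec R. I \<subseteq> p}"

definition min_primes :: "('a, 'r) ring_scheme \<Rightarrow> 'a set \<Rightarrow> 'a set set"
  where "min_primes R I = {p \<in> Var R I. \<forall>q \<in> Var R I. q \<subseteq> p \<longrightarrow> q = p}"

definition radical :: "('a, 'r) ring_scheme \<Rightarrow> 'a set \<Rightarrow> 'a set"
  where "radical R I = {r \<in> carrier R. \<exists>n::nat. r [^]\<^bsub>R\<^esub> n \<in> I}"

definition annihilator ::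
    "('a, 'r) ring_scheme \<Rightarrow> ('a, 'm, 'c) module_scheme \<Rightarrow> 'm \<Rightarrow> 'a set"
  where "annihilator R M x = {r \<in> carrier R. r \<odot>\<^bsub>M\<^esub> x = \<zero>\<^bsub>M\<^esub>}"

definition weak_assassin ::
    "('a, 'r) ring_scheme \<Rightarrow> ('a, 'm, 'c) module_scheme \<Rightarrow> 'a set set"
  where "weak_assassin R M =
    {p \<in> Spec R. \<exists>x \<in> carrier M. p \<in> min_primes R (annihilator R M x)}"

definition large_torsion ::
    "('a, 'r) ring_scheme \<Rightarrow> 'a set \<Rightarrow> ('a, 'm, 'c) module_scheme \<Rightarrow> 'm set"
  where "large_torsion R I M =
    {x \<in> carrier M. I \<subseteq> radical R (annihilator R M x)}"

lemma (in module) large_torsion_submodule: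
  assumes "ideal I R"
  shows "submodule (large_torsion R I M) R M"
proof -
  have iff: "x \<in> large_torsion R I M \<longleftrightarrow>
      x \<in> carrier M \<and> (\<forall>r\<in>I. \<exists>n::nat. (r [^] n) \<odot>\<^bsub>M\<^esub> x = \<zero>\<^bsub>M\<^esub>)" for x
    using ideal.Icarr[OF assms]
    by (auto simp: large_torsion_def radical_def annihilator_def)
  show ?thesis
  proof (rule submoduleI)
    show "large_torsion R I M \<subseteq> carrier M"
      by (auto simp: iff)
    show "\<zero>\<^bsub>M\<^esub> \<in> large_torsion R I M"
      using ideal.Icarr[OF assms] by (auto simp: iff)
    show "\<ominus>\<^bsub>M\<^esub> x \<in> large_torsion R I M" if x: "x \<in> large_torsion R I M" for x
      unfolding iff
    proof (intro conjI ballI)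
      have c: "x \<in> carrier M" using x by (simp add: iff)
      then show "\<ominus>\<^bsub>M\<^esub> x \<in> carrier M" by simp
      fix r assume r: "r \<in> I"
      obtain n :: nat where "(r [^] n) \<odot>\<^bsub>M\<^esub> x = \<zero>\<^bsub>M\<^esub>"
        using x r unfolding iff by blast
      then have "(r [^] n) \<odot>\<^bsub>M\<^esub> (\<ominus>\<^bsub>M\<^esub> x) = \<zero>\<^bsub>M\<^esub>"
        using c ideal.Icarr[OF assms r] by (simp add: smult_r_minus)
      then show "\<exists>n::nat. (r [^] n) \<odot>\<^bsub>M\<^esub> (\<ominus>\<^bsub>M\<^esub> x) = \<zero>\<^bsub>M\<^esub>" ..
    qed
    show "s \<odot>\<^bsub>M\<^esub> x \<in> large_torsion R I M"
      if s: "s \<in> carrier R" and x: "x \<in> large_torsion R I M" for s x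
      unfolding iff
    proof (intro conjI ballI)
      have c: "x \<in> carrier M" using x by (simp add: iff)
      then show "s \<odot>\<^bsub>M\<^esub> x \<in> carrier M" using s by simp
      fix r assume r: "r \<in> I"
      then have rc: "r \<in> carrier R" by (rule ideal.Icarr[OF assms])
      obtain n :: nat where n: "(r [^] n) \<odot>\<^bsub>M\<^esub> x = \<zero>\<^bsub>M\<^esub>"
        using x r unfolding iff by blast
      have "(r [^] n) \<odot>\<^bsub>M\<^esub> (s \<odot>\<^bsub>M\<^esub> x) = (s \<otimes> r [^] n) \<odot>\<^bsub>M\<^esub> x"
        using s rc c by (simp add: smult_assoc1[symmetric] R.m_comm)
      also have "\<dots> = \<zero>\<^bsub>M\<^esub>"
        using s rc c n by (simp add: smult_assoc1)
      finally show "\<exists>n::nat. (r [^] n) \<odot>\<^bsub>M\<^esub> (s \<odot>\<^bsub>M\<^esub> x) = \<zero>\<^bsub>M\<^esub>" ..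
    qed
    show "x \<oplus>\<^bsub>M\<^esub> y \<in> large_torsion R I M"
      if x: "x \<in> large_torsion R I M" and y: "y \<in> large_torsion R I M" for x y
      unfolding iff
    proof (intro conjI ballI)
      have c: "x \<in> carrier M" "y \<in> carrier M"
        using x y by (auto simp: iff)
      then show "x \<oplus>\<^bsub>M\<^esub> y \<in> carrier M" by simp
      fix r assume r: "r \<in> I"
      then have rc: "r \<in> carrier R" by (rule ideal.Icarr[OF assms])
      obtain m n :: nat where mn: "(r [^] m) \<odot>\<^bsub>M\<^esub> x = \<zero>\<^bsub>M\<^esub>" "(r [^] n) \<odot>\<^bsub>M\<^esub> y = \<zero>\<^bsub>M\<^esub>"
        using x y r unfolding iff by blast
      have "(r [^] (m + n)) \<odot>\<^bsub>M\<^esub> x = \<zero>\<^bsub>M\<^esub>"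
        using rc c mn by (simp add: R.nat_pow_mult[symmetric] R.m_comm[of "r [^] m"] smult_assoc1)
      moreover have "(r [^] (m + n)) \<odot>\<^bsub>M\<^esub> y = \<zero>\<^bsub>M\<^esub>"
        using rc c mn by (simp add: R.nat_pow_mult[symmetric] smult_assoc1)
      ultimately have "(r [^] (m + n)) \<odot>\<^bsub>M\<^esub> (x \<oplus>\<^bsub>M\<^esub> y) = \<zero>\<^bsub>M\<^esub>"
        using rc c by (simp add: smult_r_distr)
      then show "\<exists>n::nat. (r [^] n) \<odot>\<^bsub>M\<^esub> (x \<oplus>\<^bsub>M\<^esub> y) = \<zero>\<^bsub>M\<^esub>" ..
    qed
  qed
qed

(* HOL cannot quantify over types inside a formula, so "every R-module" ranges over all
   R-modules whose carrier is a subset of a type 'm, which is an explicit parameter.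
   The large torsion submodule is regarded as an R-module by restricting the carrier. *)
definition weakly_large_quasifair ::
    "'m itself \<Rightarrow> ('a, 'r) ring_scheme \<Rightarrow> 'a set \<Rightarrow> bool"
  where "weakly_large_quasifair (_ :: 'm itself) R I \<longleftrightarrow>
    (\<forall>M :: ('a, 'm) module. module R M \<longrightarrow>
      weak_assassin R (M\<lparr>carrier := large_torsion R I M\<rparr>) = weak_assassin R M \<inter> Var R I)"

end

theory Submission
  imports "HOL-Algebra.Ring_Divisibility" Defs
begin

text \<open>
  Write \<open>\<Gamma> M\<close> for the large torsion submodule. One inclusion between the sets of weakly
  associated primes always holds: a prime that is minimal over the annihilator of a torsion element \<open>x\<close> contains
  the radical of that annihilator and hence \<open>\<aa>\<close>, so quasifairness is only about
  \<open>Ass M \<inter> Var \<aa> \<subseteq> Ass (\<Gamma> M)\<close>.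

  Given quasifairness, (ii) is the statement that a module is zero iff it has no weakly associated
  prime, applied to \<open>\<Gamma> M\<close> (\<open>weak_assassin_large_torsion_empty_iff\<close>). This rests on the existence of
  minimal primes over a proper ideal.

  For the converse, the point is that \<open>\<Gamma>\<close> is a radical: \<open>\<Gamma> (M / \<Gamma> M) = 0\<close>
  (\<open>exists_large_torsion_quotient\<close>). Let \<open>p\<close> contain \<open>\<aa>\<close> and be minimal over the annihilator of
  \<open>x \<in> M\<close>. By (ii) for the torsion-free module \<open>M / \<Gamma> M\<close>, the prime \<open>p\<close> is not weakly associated to
  that quotient, so it is not minimal over the annihilator of the residue class of \<open>x\<close>. That
  annihilator contains the one of \<open>x\<close>, so the only possible reason is that it is not inside \<open>p\<close>: some
  \<open>r \<notin> p\<close> has \<open>r x \<in> \<Gamma> M\<close>. Multiplying by an element outside \<open>p\<close> keeps the annihilator inside \<open>p\<close>,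
  so \<open>r x\<close> witnesses that \<open>p\<close> is weakly associated to \<open>\<Gamma> M\<close>
  (\<open>weak_assassin_large_torsion_multiple\<close>).
\<close>

section \<open>Existence of minimal primes\<close>

text \<open>Krull: an ideal that is maximal among those avoiding \<open>\<one>\<close> is a maximal ideal, hence prime.\<close>

lemma (in cring) Var_nonempty:
  assumes I: "ideal I R" and proper: "\<one> \<notin> I"
  shows "Var R I \<noteq> {}"
proof -
  let ?A = "{J. ideal J R \<and> I \<subseteq> J \<and> \<one> \<notin> J}"
  have "\<exists>J\<in>?A. \<forall>X\<in>?A. J \<subseteq> X \<longrightarrow> X = J"
  proof (rule subset_Zorn_nonempty)
    show "?A \<noteq> {}" using I proper by blast
    fix C assume ne: "C \<noteq> {}" and ch: "subset.chain ?A C"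
    then have "subset.chain {J. ideal J R} C"
      unfolding subset_chain_def by blast
    from chain_Union_is_ideal[OF this] ne have "ideal (\<Union>C) R" by simp
    then show "\<Union>C \<in> ?A"
      using ne ch unfolding subset_chain_def by blast
  qed
  then obtain J where J: "ideal J R" "I \<subseteq> J" "\<one> \<notin> J"
    and max: "\<And>X. ideal X R \<Longrightarrow> J \<subseteq> X \<Longrightarrow> \<one> \<notin> X \<Longrightarrow> X = J"
    by (smt (verit) mem_Collect_eq subset_trans)
  have "maximalideal J R"
  proof (rule maximalidealI[OF J(1)])
    show "carrier R \<noteq> J" using J(3) by blast
    show "X = J \<or> X = carrier R" if "ideal X R" "J \<subseteq> X" for X
      using max[OF that] ideal.one_imp_carrier[OF that(1)] by blast
  qed
  then show ?thesis
    using maximalideal_prime J(2) unfolding Var_def Spec_def by blast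
qed

lemma (in cring) primeideal_Inter_chain:
  assumes ne: "C \<noteq> {}" and prime: "\<And>p. p \<in> C \<Longrightarrow> primeideal p R"
    and chain: "\<And>p q. p \<in> C \<Longrightarrow> q \<in> C \<Longrightarrow> p \<subseteq> q \<or> q \<subseteq> p"
  shows "primeideal (\<Inter>C) R"
proof (rule primeidealI)
  show "ideal (\<Inter>C) R"
    using ne prime by (intro i_Intersect) (auto dest: primeideal.axioms)
  show "cring R" by (rule is_cring)
  show "carrier R \<noteq> \<Inter>C"
    using ne primeideal.I_notcarr[OF prime] ideal.Icarr[OF primeideal.axioms(1)[OF prime]]
    by blast
  fix a b assume ab: "a \<in> carrier R" "b \<in> carrier R" "a \<otimes> b \<in> \<Inter>C"
  show "a \<in> \<Inter>C \<or> b \<in> \<Inter>C"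
  proof (rule ccontr)
    assume "\<not> ?thesis"
    then obtain p q where pq: "p \<in> C" "a \<notin> p" "q \<in> C" "b \<notin> q" by blast
    \<comment> \<open>The smaller of the two primes contains neither factor.\<close>
    then obtain r where "r \<in> C" "a \<notin> r" "b \<notin> r" using chain by blast
    then show False using primeideal.I_prime[OF prime] ab by blast
  qed
qed

text \<open>Zorn's lemma for reverse inclusion, with intersections of chains of primes as bounds.\<close>

lemma (in cring) min_primes_nonempty:
  assumes "ideal I R" and "\<one> \<notin> I"
  shows "min_primes R I \<noteq> {}"
proof -
  let ?V = "Var R I"
  have "\<exists>m\<in>?V. \<forall>a\<in>?V. a \<subseteq> m \<longrightarrow> a = m"
  proof (rule predicate_Zorn)
    show "partial_order_on ?V (relation_of (\<lambda>x y. y \<subseteq> x) ?V)"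
      by (rule partial_order_on_relation_ofI) auto
    fix C assume C: "C \<in> Chains (relation_of (\<lambda>x y. y \<subseteq> x) ?V)"
    then have CV: "C \<subseteq> ?V" and tot: "\<And>p q. p \<in> C \<Longrightarrow> q \<in> C \<Longrightarrow> p \<subseteq> q \<or> q \<subseteq> p"
      unfolding Chains_def relation_of_def by auto
    show "\<exists>u\<in>?V. \<forall>a\<in>C. u \<subseteq> a"
    proof (cases "C = {}")
      case True
      then show ?thesis using Var_nonempty[OF assms] by blast
    next
      case False
      then have "primeideal (\<Inter>C) R"
        using CV tot by (intro primeideal_Inter_chain) (auto simp: Var_def Spec_def)
      then have "\<Inter>C \<in> ?V"
        using CV False unfolding Var_def Spec_def by blast
      then show ?thesis by blast
    qed
  qed
  then show ?thesis unfolding min_primes_def by blast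
qed

text \<open>
  Enlarging an ideal inside a minimal prime only removes competitors. Because of this, a weakly
  associated prime survives passage to a quotient or a multiple as soon as the new annihilator is
  still contained in it.
\<close>

lemma min_primes_between:
  assumes "p \<in> min_primes R I" and "I \<subseteq> J" and "J \<subseteq> p"
  shows "p \<in> min_primes R J"
  using assms unfolding min_primes_def Var_def by blast

section \<open>Annihilators and weakly associated primes\<close>

lemma (in module) annihilator_ideal:
  assumes x: "x \<in> carrier M"
  shows "ideal (annihilator R M x) R"
proof (rule idealI)
  show "ring R" by (rule R.ring_axioms)
  show "subgroup (annihilator R M x) (add_monoid R)"
    using x by (intro R.add.subgroupI)
      (auto simp: annihilator_def smult_l_distr smult_l_minus a_inv_def[symmetric])
  fix a s assume a: "a \<in> annihilator R M x" and s: "s \<in> carrier R"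
  then show "s \<otimes> a \<in> annihilator R M x"
    using x by (simp add: annihilator_def smult_assoc1)
  then show "a \<otimes> s \<in> annihilator R M x"
    using a s by (simp add: annihilator_def R.m_comm)
qed

lemma (in module) min_primes_annihilator_empty_iff:
  assumes x: "x \<in> carrier M"
  shows "min_primes R (annihilator R M x) = {} \<longleftrightarrow> x = \<zero>\<^bsub>M\<^esub>"
proof
  assume "min_primes R (annihilator R M x) = {}"
  then have "\<one> \<in> annihilator R M x"
    using R.min_primes_nonempty[OF annihilator_ideal[OF x]] by blast
  then show "x = \<zero>\<^bsub>M\<^esub>" using x by (simp add: annihilator_def)
next
  assume "x = \<zero>\<^bsub>M\<^esub>"
  then have ann: "annihilator R M x = carrier R" by (auto simp: annihilator_def)
  have "\<not> carrier R \<subseteq> p" if "primeideal p R" for p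
  proof -
    interpret p: primeideal p R by fact
    show ?thesis using p.I_notcarr p.a_subset by blast
  qed
  then show "min_primes R (annihilator R M x) = {}"
    unfolding ann min_primes_def Var_def Spec_def by blast
qed

text \<open>Annihilators do not depend on the module in which an element is considered.\<close>

lemma weak_assassin_large_torsion_eq:
  "weak_assassin R (M\<lparr>carrier := large_torsion R I M\<rparr>) =
    {p \<in> Spec R. \<exists>x\<in>large_torsion R I M. p \<in> min_primes R (annihilator R M x)}"
  by (simp add: weak_assassin_def annihilator_def)

lemma (in module) zero_in_large_torsion:
  assumes "ideal I R"
  shows "\<zero>\<^bsub>M\<^esub> \<in> large_torsion R I M"
  using ideal.Icarr[OF assms] by (auto simp: large_torsion_def radical_def annihilator_def)

lemma (in module) weak_assassin_large_torsion_empty_iff: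
  assumes "ideal I R"
  shows "weak_assassin R (M\<lparr>carrier := large_torsion R I M\<rparr>) = {} \<longleftrightarrow>
    large_torsion R I M = {\<zero>\<^bsub>M\<^esub>}" (is "?L \<longleftrightarrow> ?G = _")
proof -
  have G: "?G \<subseteq> carrier M" "\<zero>\<^bsub>M\<^esub> \<in> ?G"
    using zero_in_large_torsion[OF assms] by (auto simp: large_torsion_def)
  have "?L \<longleftrightarrow> (\<forall>x\<in>?G. min_primes R (annihilator R M x) = {})"
    unfolding weak_assassin_large_torsion_eq min_primes_def Var_def by blast
  also have "\<dots> \<longleftrightarrow> (\<forall>x\<in>?G. x = \<zero>\<^bsub>M\<^esub>)"
    using G(1) min_primes_annihilator_empty_iff by blast
  also have "\<dots> \<longleftrightarrow> ?G = {\<zero>\<^bsub>M\<^esub>}" using G(2) by blast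
  finally show ?thesis .
qed

lemma (in cring) radical_subset_prime:
  assumes "primeideal p R" and "I \<subseteq> p"
  shows "radical R I \<subseteq> p"
proof
  interpret p: primeideal p R by fact
  fix r assume "r \<in> radical R I"
  then obtain n :: nat where r: "r \<in> carrier R" and n: "r [^] n \<in> p"
    using assms(2) unfolding radical_def by blast
  show "r \<in> p" using n
  proof (induction n)
    case 0
    then show ?case using p.one_imp_carrier r by simp
  next
    case (Suc n)
    then show ?case using p.I_prime[of "r [^] n" r] r by auto
  qed
qed

lemma (in module) weak_assassin_large_torsion_subset:
  "weak_assassin R (M\<lparr>carrier := large_torsion R I M\<rparr>) \<subseteq> weak_assassin R M \<inter> Var R I"
proof
  fix p assume "p \<in> weak_assassin R (M\<lparr>carrier := large_torsion R I M\<rparr>)"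
  then obtain x where p: "p \<in> Spec R" and x: "x \<in> large_torsion R I M"
    and min: "p \<in> min_primes R (annihilator R M x)"
    unfolding weak_assassin_large_torsion_eq by blast
  have "I \<subseteq> radical R (annihilator R M x)"
    using x by (simp add: large_torsion_def)
  also have "\<dots> \<subseteq> p"
    using min by (intro R.radical_subset_prime) (auto simp: min_primes_def Var_def Spec_def)
  finally show "p \<in> weak_assassin R M \<inter> Var R I"
    using p x min unfolding weak_assassin_def large_torsion_def Var_def by blast
qed

section \<open>Quotient modules on coset representatives\<close>

text \<open>
  A quotient whose elements are cosets would have type \<open>'m set\<close>, whereas the modules quantified over
  in the theorem are all carried by \<open>'m\<close>. The quotient is therefore realised on a set of coset
  representatives: \<open>\<pi>\<close> picks one representative from each coset, and the operations of \<open>N\<close> are those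
  of \<open>M\<close> followed by \<open>\<pi>\<close>.
\<close>

lemma exists_quotient_module:
  fixes R :: "('a, 'r) ring_scheme" and M :: "('a, 'm) module"
  assumes "module R M" and "submodule T R M"
  obtains N :: "('a, 'm) module" and \<pi> :: "'m \<Rightarrow> 'm"
  where "module R N" and "\<pi> ` carrier M = carrier N"
    and "\<And>r x. r \<in> carrier R \<Longrightarrow> x \<in> carrier M \<Longrightarrow> \<pi> (r \<odot>\<^bsub>M\<^esub> x) = r \<odot>\<^bsub>N\<^esub> \<pi> x"
    and "\<And>x. x \<in> carrier M \<Longrightarrow> \<pi> x = \<zero>\<^bsub>N\<^esub> \<longleftrightarrow> x \<in> T"
proof -
  interpret module R M by fact
  interpret T: submodule T R M by fact
  interpret T: abelian_subgroup T M
    by (intro abelian_subgroupI3 additive_subgroupI T.subgroup_axioms M.abelian_group_axioms)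
  define \<pi> where "\<pi> x = (SOME y. y \<in> T +>\<^bsub>M\<^esub> x)" for x
  have \<pi>_T: "\<exists>t\<in>T. \<pi> x = t \<oplus>\<^bsub>M\<^esub> x" if "x \<in> carrier M" for x
  proof -
    have "\<pi> x \<in> T +>\<^bsub>M\<^esub> x"
      unfolding \<pi>_def using T.a_rcos_self[OF that] by (rule someI)
    then show ?thesis by (auto simp: a_r_coset_def')
  qed
  have \<pi>_closed [simp]: "\<pi> x \<in> carrier M" if "x \<in> carrier M" for x
    using \<pi>_T[OF that] that T.a_Hcarr by auto
  have \<pi>_eq: "\<pi> (t \<oplus>\<^bsub>M\<^esub> x) = \<pi> x" if "t \<in> T" "x \<in> carrier M" for t x
  proof -
    have "t \<oplus>\<^bsub>M\<^esub> x \<in> T +>\<^bsub>M\<^esub> x" using that by (auto simp: a_r_coset_def')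
    then show ?thesis using T.a_repr_independence'[OF _ that(2)] by (simp add: \<pi>_def)
  qed
  have \<pi>_idem [simp]: "\<pi> (\<pi> x) = \<pi> x" if "x \<in> carrier M" for x
    using \<pi>_T[OF that] \<pi>_eq that by auto
  have \<pi>_add_right [simp]: "\<pi> (x \<oplus>\<^bsub>M\<^esub> \<pi> y) = \<pi> (x \<oplus>\<^bsub>M\<^esub> y)"
    if xy: "x \<in> carrier M" "y \<in> carrier M" for x y
  proof -
    obtain t where t: "t \<in> T" "\<pi> y = t \<oplus>\<^bsub>M\<^esub> y" using \<pi>_T xy by blast
    then have "x \<oplus>\<^bsub>M\<^esub> \<pi> y = t \<oplus>\<^bsub>M\<^esub> (x \<oplus>\<^bsub>M\<^esub> y)"
      using xy T.a_Hcarr[OF t(1)] by (simp add: M.a_lcomm)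
    then show ?thesis using \<pi>_eq t xy by simp
  qed
  then have \<pi>_add_left [simp]: "\<pi> (\<pi> x \<oplus>\<^bsub>M\<^esub> y) = \<pi> (x \<oplus>\<^bsub>M\<^esub> y)"
    if "x \<in> carrier M" "y \<in> carrier M" for x y
    using that by (metis M.a_comm \<pi>_closed)
  have \<pi>_smult [simp]: "\<pi> (r \<odot>\<^bsub>M\<^esub> \<pi> x) = \<pi> (r \<odot>\<^bsub>M\<^esub> x)"
    if rx: "r \<in> carrier R" "x \<in> carrier M" for r x
  proof -
    obtain t where t: "t \<in> T" "\<pi> x = t \<oplus>\<^bsub>M\<^esub> x" using \<pi>_T rx by blast
    then have "r \<odot>\<^bsub>M\<^esub> \<pi> x = r \<odot>\<^bsub>M\<^esub> t \<oplus>\<^bsub>M\<^esub> r \<odot>\<^bsub>M\<^esub> x"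
      using rx T.a_Hcarr[OF t(1)] by (simp add: smult_r_distr)
    then show ?thesis using \<pi>_eq t rx by simp
  qed
  have \<pi>_zero: "\<pi> x = \<pi> \<zero>\<^bsub>M\<^esub> \<longleftrightarrow> x \<in> T" if x: "x \<in> carrier M" for x
  proof
    obtain t s where t: "t \<in> T" "\<pi> x = t \<oplus>\<^bsub>M\<^esub> x" and s: "s \<in> T" "\<pi> \<zero>\<^bsub>M\<^esub> = s"
      using \<pi>_T[OF x] \<pi>_T[OF M.zero_closed] T.a_Hcarr by auto
    assume "\<pi> x = \<pi> \<zero>\<^bsub>M\<^esub>"
    then have "x = \<ominus>\<^bsub>M\<^esub> t \<oplus>\<^bsub>M\<^esub> s"
      using t s x T.a_Hcarr by (metis M.r_neg2 M.minus_minus M.a_inv_closed)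
    then show "x \<in> T" using s t by (simp add: T.a_inv_closed)
  next
    assume "x \<in> T"
    then show "\<pi> x = \<pi> \<zero>\<^bsub>M\<^esub>" using \<pi>_eq[of x "\<zero>\<^bsub>M\<^esub>"] x by simp
  qed
  \<comment> \<open>The \<open>mult\<close> and \<open>one\<close> fields of a module record carry no meaning; those of \<open>M\<close> serve as fillers.\<close>
  define N :: "('a, 'm) module" where
    "N = \<lparr>carrier = \<pi> ` carrier M, monoid.mult = mult M, one = one M,
      zero = \<pi> \<zero>\<^bsub>M\<^esub>, add = (\<lambda>x y. \<pi> (x \<oplus>\<^bsub>M\<^esub> y)), smult = (\<lambda>r x. \<pi> (r \<odot>\<^bsub>M\<^esub> x))\<rparr>"
  have "abelian_group N"
  proof (rule abelian_groupI)
    fix x assume "x \<in> carrier N"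
    then obtain u where u: "u \<in> carrier M" "x = \<pi> u" by (auto simp: N_def)
    then have "\<pi> (\<ominus>\<^bsub>M\<^esub> u) \<oplus>\<^bsub>N\<^esub> x = \<zero>\<^bsub>N\<^esub>" by (simp add: N_def M.l_neg)
    then show "\<exists>y\<in>carrier N. y \<oplus>\<^bsub>N\<^esub> x = \<zero>\<^bsub>N\<^esub>" using u by (auto simp: N_def)
  next
    fix x y z assume "x \<in> carrier N" "y \<in> carrier N" "z \<in> carrier N"
    then show "(x \<oplus>\<^bsub>N\<^esub> y) \<oplus>\<^bsub>N\<^esub> z = x \<oplus>\<^bsub>N\<^esub> (y \<oplus>\<^bsub>N\<^esub> z)"
      by (auto simp: N_def M.a_assoc)
  next
    fix x y assume "x \<in> carrier N" "y \<in> carrier N"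
    then show "x \<oplus>\<^bsub>N\<^esub> y = y \<oplus>\<^bsub>N\<^esub> x"
      by (auto simp: N_def M.a_comm)
  qed (auto simp: N_def)
  then have "module R N"
    by (intro moduleI R.is_cring)
      (auto simp: N_def, auto simp: smult_l_distr smult_r_distr smult_assoc1)
  then show thesis
    by (rule that[of N \<pi>]) (auto simp: N_def \<pi>_zero)
qed

section \<open>The large torsion functor is a radical\<close>

text \<open>
  Torsion is tested one ring element at a time, so if \<open>r^n x\<close> is killed by \<open>r^m\<close>, then \<open>x\<close> is killed
  by \<open>r^(m+n)\<close>. (For the small torsion functor, which asks for a common power of the whole ideal,
  this fails in general.)
\<close>

lemma (in module) large_torsion_closed_under_roots:
  assumes I: "ideal I R" and x: "x \<in> carrier M"
    and roots: "\<And>r. r \<in> I \<Longrightarrow> \<exists>n::nat. (r [^] n) \<odot>\<^bsub>M\<^esub> x \<in> large_torsion R I M"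
  shows "x \<in> large_torsion R I M"
proof -
  have "\<exists>k::nat. (r [^] k) \<odot>\<^bsub>M\<^esub> x = \<zero>\<^bsub>M\<^esub>" if r: "r \<in> I" for r
  proof -
    have rc: "r \<in> carrier R" using ideal.Icarr[OF I r] .
    obtain n :: nat where n: "(r [^] n) \<odot>\<^bsub>M\<^esub> x \<in> large_torsion R I M"
      using roots[OF r] by blast
    then obtain m :: nat where "(r [^] m) \<odot>\<^bsub>M\<^esub> ((r [^] n) \<odot>\<^bsub>M\<^esub> x) = \<zero>\<^bsub>M\<^esub>"
      using r unfolding large_torsion_def radical_def annihilator_def by blast
    then have "(r [^] (m + n)) \<odot>\<^bsub>M\<^esub> x = \<zero>\<^bsub>M\<^esub>"
      using rc x by (simp add: R.nat_pow_mult[symmetric] smult_assoc1)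
    then show ?thesis ..
  qed
  then show ?thesis
    using x ideal.Icarr[OF I] by (auto simp: large_torsion_def radical_def annihilator_def)
qed

text \<open>
  \<open>N\<close> is \<open>M / \<Gamma> M\<close>; a class is torsion iff for every \<open>r\<close> in the ideal some \<open>r^n\<close> moves a representative
  into \<open>\<Gamma> M\<close>, and then the representative itself lies in \<open>\<Gamma> M\<close>.
\<close>

lemma exists_large_torsion_quotient:
  fixes R :: "('a, 'r) ring_scheme" and M :: "('a, 'm) module"
  assumes M: "module R M" and I: "ideal I R"
  obtains N :: "('a, 'm) module" and \<pi> :: "'m \<Rightarrow> 'm"
  where "module R N" and "large_torsion R I N = {\<zero>\<^bsub>N\<^esub>}" and "\<pi> ` carrier M = carrier N"
    and "\<And>x. x \<in> carrier M \<Longrightarrow>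
      annihilator R N (\<pi> x) = {r \<in> carrier R. r \<odot>\<^bsub>M\<^esub> x \<in> large_torsion R I M}"
proof -
  interpret module R M by fact
  let ?T = "large_torsion R I M"
  obtain N :: "('a, 'm) module" and \<pi> :: "'m \<Rightarrow> 'm" where N: "module R N" "\<pi> ` carrier M = carrier N"
    and lin: "\<And>r x. r \<in> carrier R \<Longrightarrow> x \<in> carrier M \<Longrightarrow> \<pi> (r \<odot>\<^bsub>M\<^esub> x) = r \<odot>\<^bsub>N\<^esub> \<pi> x"
    and ker: "\<And>x. x \<in> carrier M \<Longrightarrow> \<pi> x = \<zero>\<^bsub>N\<^esub> \<longleftrightarrow> x \<in> ?T"
    by (rule exists_quotient_module[OF M large_torsion_submodule[OF I]]) (rule that)
  interpret N: module R N by fact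
  have ann: "annihilator R N (\<pi> x) = {r \<in> carrier R. r \<odot>\<^bsub>M\<^esub> x \<in> ?T}"
    if "x \<in> carrier M" for x
    using that by (auto simp: annihilator_def lin[symmetric] ker)
  have "y = \<zero>\<^bsub>N\<^esub>" if y: "y \<in> large_torsion R I N" for y
  proof -
    obtain x where x: "x \<in> carrier M" "y = \<pi> x"
      using y N(2) by (auto simp: large_torsion_def)
    have "\<exists>n::nat. (r [^]\<^bsub>R\<^esub> n) \<odot>\<^bsub>M\<^esub> x \<in> ?T" if "r \<in> I" for r
      using y x that by (auto simp: large_torsion_def radical_def ann)
    then show ?thesis
      using large_torsion_closed_under_roots[OF I x(1)] ker x by blast
  qed
  then have "large_torsion R I N = {\<zero>\<^bsub>N\<^esub>}"
    using N.zero_in_large_torsion[OF I] by blast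
  then show thesis using that N ann by blast
qed

section \<open>The equivalence\<close>

text \<open>
  If \<open>s\<close> kills \<open>r x\<close>, then \<open>s r\<close> kills \<open>x\<close> and so lies in \<open>p\<close>; since \<open>r \<notin> p\<close>, the prime \<open>p\<close>
  contains \<open>s\<close>. Hence \<open>p\<close> is still minimal over the annihilator of \<open>r x\<close>.
\<close>

lemma (in module) weak_assassin_large_torsion_multiple:
  assumes p: "p \<in> min_primes R (annihilator R M x)" and x: "x \<in> carrier M"
    and r: "r \<in> carrier R" "r \<notin> p" and rx: "r \<odot>\<^bsub>M\<^esub> x \<in> large_torsion R I M"
  shows "p \<in> weak_assassin R (M\<lparr>carrier := large_torsion R I M\<rparr>)"
proof -
  have prime: "primeideal p R" and sub: "annihilator R M x \<subseteq> p"
    using p by (auto simp: min_primes_def Var_def Spec_def)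
  have "annihilator R M x \<subseteq> annihilator R M (r \<odot>\<^bsub>M\<^esub> x)"
    using r x by (auto simp: annihilator_def smult_assoc1[symmetric] R.m_comm[of _ r])
      (simp add: smult_assoc1)
  moreover have "annihilator R M (r \<odot>\<^bsub>M\<^esub> x) \<subseteq> p"
  proof
    fix s assume "s \<in> annihilator R M (r \<odot>\<^bsub>M\<^esub> x)"
    then have s: "s \<in> carrier R" "s \<otimes> r \<in> annihilator R M x"
      using r x by (auto simp: annihilator_def smult_assoc1)
    then show "s \<in> p" using primeideal.I_prime[OF prime] sub r by blast
  qed
  ultimately have "p \<in> min_primes R (annihilator R M (r \<odot>\<^bsub>M\<^esub> x))"
    using min_primes_between[OF p] by blast
  then show ?thesis
    using rx prime unfolding weak_assassin_large_torsion_eq Spec_def by blast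
qed

theorem mainTheorem2:
  fixes R :: "('a, 'r) ring_scheme" and \<aa> :: "'a set"
  assumes "cring R" and "ideal \<aa> R"
  shows "weakly_large_quasifair TYPE('m) R \<aa> \<longleftrightarrow>
    (\<forall>M :: ('a, 'm) module. module R M \<longrightarrow>
      (large_torsion R \<aa> M = {\<zero>\<^bsub>M\<^esub>} \<longleftrightarrow> weak_assassin R M \<inter> Var R \<aa> = {}))"
    (is "?fair \<longleftrightarrow> ?detects")
proof
  assume ?fair
  then show ?detects
    using module.weak_assassin_large_torsion_empty_iff[OF _ assms(2)]
    unfolding weakly_large_quasifair_def by metis
next
  assume detects: ?detects
  have "weak_assassin R M \<inter> Var R \<aa> \<subseteq> weak_assassin R (M\<lparr>carrier := large_torsion R \<aa> M\<rparr>)"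
    if M: "module R M" for M :: "('a, 'm) module"
  proof
    interpret M: module R M by fact
    fix p assume p: "p \<in> weak_assassin R M \<inter> Var R \<aa>"
    then obtain x where x: "x \<in> carrier M" and min: "p \<in> min_primes R (annihilator R M x)"
      by (auto simp: weak_assassin_def)
    obtain N :: "('a, 'm) module" and \<pi> :: "'m \<Rightarrow> 'm"
      where N: "module R N" "large_torsion R \<aa> N = {\<zero>\<^bsub>N\<^esub>}"
        "\<pi> ` carrier M = carrier N"
      and ann_quotient: "\<And>y. y \<in> carrier M \<Longrightarrow>
        annihilator R N (\<pi> y) = {r \<in> carrier R. r \<odot>\<^bsub>M\<^esub> y \<in> large_torsion R \<aa> M}"
      by (rule exists_large_torsion_quotient[OF M assms(2)]) (rule that)
    note ann = ann_quotient[OF x]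
    have "p \<notin> weak_assassin R N" using detects N p by blast
    then have "p \<notin> min_primes R (annihilator R N (\<pi> x))"
      using N(3) x p unfolding weak_assassin_def by blast
    moreover have "annihilator R M x \<subseteq> annihilator R N (\<pi> x)"
      unfolding ann using M.zero_in_large_torsion[OF assms(2)] by (auto simp: annihilator_def)
    ultimately have "\<not> annihilator R N (\<pi> x) \<subseteq> p"
      using min_primes_between[OF min] by blast
    then obtain r where "r \<in> carrier R" "r \<notin> p" "r \<odot>\<^bsub>M\<^esub> x \<in> large_torsion R \<aa> M"
      unfolding ann by blast
    then show "p \<in> weak_assassin R (M\<lparr>carrier := large_torsion R \<aa> M\<rparr>)"
      using M.weak_assassin_large_torsion_multiple[OF min x] by blast
  qed
  then show ?fair
    unfolding weakly_large_quasifair_def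
    using module.weak_assassin_large_torsion_subset by blast
qed

end
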